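(* Let $s$ be a positive integer. (1) Let $\{k_n\}_{n\ge 1}$ be a sequence of integers $k_n\ge 2$ such that $\omega(k_n)$ is uniformly bounded and all primes dividing $k_n$ tend to infinity as $n\to\infty$ (that is, the smallest prime factor of $k_n$ tends to infinity). Then for every integer $r\ge 1$, $$\lim_{n\to\infty}\left(\frac{1}{k_n^{s(r+1)}}\sum_{j=1}^{k_n^s}j^r c_{k_n}^{(s)}(j)\right)=1-\frac{1}{r+1}.$$ (2) For every real $\lambda>1$ there exists a sequence $\{k_n\}$ of positive integers with $\omega(k_n)\sim(\lambda-1)\frac{n}{\log n}$ as $n\to\infty$ such that, for every integer $r\ge 1$, $$\lim_{n\to\infty}\left(\frac{1}{k_n^{s(r+1)}}\sum_{j=1}^{k_n^s}j^r c_{k_n}^{(s)}(j)\right)=1-\frac{1}{r+1}.$$ (3) For every real $\lambda>1$ there exists a sequence $\{k_n\}$ of positive integers with $\omega(k_n)\sim(\lambda-1)\frac{n}{\log n}$ as $n\to\infty$ such that, for every integer $r\ge 1$, $$\lim_{n\to\infty}\left(\frac{1}{k_n^{s(r+1)}}\sum_{j=1}^{k_n^s}j^r c_{k_n}^{(s)}(j)\right)=\frac{2^s-1}{2^s}-\frac{S_r(2^s)}{2^{s(r+1)}}.$$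
   Context: For positive integers $a,b,s$, the generalized GCD $(a,b)_s$ is the largest $d^s$ with $d\in\mathbb{N}$ such that $d^s\mid a$ and $d^s\mid b$. For positive integers $k,s$ and an integer $j$, the generalized (Cohen) Ramanujan sum is $$c_k^{(s)}(j)=\sum_{\substack{1\le m\le k^s\\ (m,k^s)_s=1}}e^{2\pi i jm/k^s}.$$ $\omega(k)$ is the number of distinct prime divisors of $k$. For an integer $n>1$, $S_r(n)=\sum_{j=1}^{n-1}j^r$. *)

theory Defs
  imports
    Complex_Main
    "HOL-Computational_Algebra.Primes"
    "HOL-Library.Landau_Symbols"
begin

(* Meaningful for a, b, s > 0: then the set is finite, contains 1 ^ s, and d = 0 is excluded
   because 0 ^ s = 0 does not divide a. *)
definition gen_gcd :: "nat \<Rightarrow> nat \<Rightarrow> nat \<Rightarrow> nat" where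
  "gen_gcd s a b = Max {d ^ s | d. d ^ s dvd a \<and> d ^ s dvd b}"

definition cohen_sum :: "nat \<Rightarrow> nat \<Rightarrow> int \<Rightarrow> complex" where
  "cohen_sum s k j =
     (\<Sum>m | 1 \<le> m \<and> m \<le> k ^ s \<and> gen_gcd s m (k ^ s) = 1.
        exp (2 * of_real pi * \<i> * of_int j * of_nat m / of_nat (k ^ s)))"

definition cohen_moment :: "nat \<Rightarrow> nat \<Rightarrow> nat \<Rightarrow> complex" where
  "cohen_moment s r k =
     1 / of_nat (k ^ (s * (r + 1))) * (\<Sum>j = 1..k ^ s. of_nat (j ^ r) * cohen_sum s k (int j))"

definition omega :: "nat \<Rightarrow> nat" where
  "omega k = card (prime_factors k)"

definition power_sum :: "nat \<Rightarrow> nat \<Rightarrow> nat" where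
  "power_sum r n = (\<Sum>j = 1..n - 1. j ^ r)"

end

theory Submission
  imports Defs "HOL-Analysis.Analysis" "HOL-Real_Asymp.Real_Asymp"
begin

text \<open>
  Inclusion-exclusion over the prime divisors \<open>p\<close> of \<open>k\<close> with \<open>p ^ s dvd m\<close> gives
  \<open>M(k) = (\<Sum>q. \<mu>(q) F(q ^ s))\<close>, where \<open>M(k)\<close> is the moment, \<open>q\<close> runs over the squarefree
  divisors of \<open>k\<close> and \<open>F(N) = (1 ^ r + \<dots> + N ^ r) / N ^ (r + 1)\<close>.
  Since \<open>1 / (r + 1) \<le> F(N) \<le> 1 / (r + 1) + 1 / N\<close> and \<open>(\<Sum>q. \<mu>(q)) = 0\<close>, the terms \<open>q > 1\<close>
  contribute \<open>- 1 / (r + 1)\<close> up to an error of at most \<open>exp (\<Sum>p. 1 / p) - 1\<close>.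
  So it suffices that the sum of the reciprocals of the prime divisors is small. For the last
  two claims this allows choosing the prescribed number of primes arbitrarily far out, so that
  no information on the distribution of primes is needed; in the last claim the extra factor
  2 subtracts the same sum with \<open>F(2 ^ s q ^ s)\<close> in place of \<open>F(q ^ s)\<close>.
\<close>

section \<open>Normalized power sums, alternating sums over prime sets, and elementary
  bounds\<close>

definition power_mean :: "nat \<Rightarrow> nat \<Rightarrow> real" where
  "power_mean r N = (\<Sum>i=1..N. real i ^ r) / real N ^ (r + 1)"

text \<open>For a set \<open>P\<close> of primes, the subsets \<open>T\<close> encode the squarefree
  numbers \<open>\<Prod>T\<close> composed of these primes, and \<open>(-1) ^ card T\<close> is the
  Moebius value of \<open>\<Prod>T\<close>. The factor \<open>a\<close> is 1 for the moment itself;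
  the value \<open>2 ^ s\<close> appears once the prime 2 is split off.\<close>

definition sieve_sum :: "nat \<Rightarrow> nat \<Rightarrow> nat \<Rightarrow> nat set \<Rightarrow> real" where
  "sieve_sum s r a P = (\<Sum>T\<in>Pow P. (-1) ^ card T * power_mean r (a * (\<Prod>T) ^ s))"

text \<open>The difference factors into \<open>r + 1\<close> products
  \<open>(x + 1) ^ p * x ^ (r - p)\<close>, each lying between \<open>x ^ r\<close> and
  \<open>(x + 1) ^ r\<close>.\<close>

lemma power_Suc_diff_bounds:
  fixes x :: real
  assumes "0 \<le> x"
  shows "(real r + 1) * x ^ r \<le> (x + 1) ^ (r + 1) - x ^ (r + 1)"
    and "(x + 1) ^ (r + 1) - x ^ (r + 1) \<le> (real r + 1) * (x + 1) ^ r"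
proof -
  have eq: "(x + 1) ^ (r + 1) - x ^ (r + 1) = (\<Sum>p<Suc r. (x + 1) ^ p * x ^ (r - p))"
    using diff_power_eq_sum[of "x + 1" r x] by simp
  have "(\<Sum>p<Suc r. x ^ r) \<le> (\<Sum>p<Suc r. (x + 1) ^ p * x ^ (r - p))"
  proof (rule sum_mono)
    fix p assume "p \<in> {..<Suc r}"
    then have "x ^ r = x ^ p * x ^ (r - p)" by (simp flip: power_add)
    also have "\<dots> \<le> (x + 1) ^ p * x ^ (r - p)"
      using assms by (intro mult_right_mono power_mono) auto
    finally show "x ^ r \<le> (x + 1) ^ p * x ^ (r - p)" .
  qed
  then show "(real r + 1) * x ^ r \<le> (x + 1) ^ (r + 1) - x ^ (r + 1)"
    unfolding eq by (simp add: algebra_simps)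
  have "(\<Sum>p<Suc r. (x + 1) ^ p * x ^ (r - p)) \<le> (\<Sum>p<Suc r. (x + 1) ^ r)"
  proof (rule sum_mono)
    fix p assume "p \<in> {..<Suc r}"
    then have "(x + 1) ^ r = (x + 1) ^ p * (x + 1) ^ (r - p)" by (simp flip: power_add)
    also have "\<dots> \<ge> (x + 1) ^ p * x ^ (r - p)"
      using assms by (intro mult_left_mono power_mono) auto
    finally show "(x + 1) ^ p * x ^ (r - p) \<le> (x + 1) ^ r" .
  qed
  then show "(x + 1) ^ (r + 1) - x ^ (r + 1) \<le> (real r + 1) * (x + 1) ^ r"
    unfolding eq by (simp add: algebra_simps)
qed

text \<open>Telescoping: each new term is compared with the increment of \<open>N ^ (r + 1)\<close>.
  In the upper bound the comparison is shifted by one: the surplus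
  \<open>(real r + 1) * real N ^ r\<close> is absorbed by the increment from \<open>N\<close> to
  \<open>Suc N\<close>, and the new term becomes the next surplus.\<close>

lemma power_sum_bounds:
  shows "real N ^ (r + 1) \<le> (real r + 1) * (\<Sum>i=1..N. real i ^ r)"
    and "(real r + 1) * (\<Sum>i=1..N. real i ^ r) \<le> real N ^ (r + 1) + (real r + 1) * real N ^ r"
proof (induction N)
  case 0
  show "real 0 ^ (r + 1) \<le> (real r + 1) * (\<Sum>i=1..0. real i ^ r)"
    and "(real r + 1) * (\<Sum>i=1..0. real i ^ r) \<le> real 0 ^ (r + 1) + (real r + 1) * real 0 ^ r"
    by simp_all
next
  case (Suc N)
  have eq: "(real r + 1) * (\<Sum>i=1..Suc N. real i ^ r) =
      (real r + 1) * (\<Sum>i=1..N. real i ^ r) + (real r + 1) * (real N + 1) ^ r"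
    by (simp add: algebra_simps)
  have S: "real (Suc N) = real N + 1" by simp
  note b = power_Suc_diff_bounds[of "real N" r, OF of_nat_0_le_iff]
  show "real (Suc N) ^ (r + 1) \<le> (real r + 1) * (\<Sum>i=1..Suc N. real i ^ r)"
    using Suc.IH(1) b(2) unfolding eq S by linarith
  show "(real r + 1) * (\<Sum>i=1..Suc N. real i ^ r)
      \<le> real (Suc N) ^ (r + 1) + (real r + 1) * real (Suc N) ^ r"
    using Suc.IH(2) b(1) unfolding eq S by linarith
qed

lemma power_mean_approx:
  assumes "N > 0"
  shows "\<bar>power_mean r N - 1 / (real r + 1)\<bar> \<le> 1 / real N"
proof -
  define S where "S = (\<Sum>i=1..N. real i ^ r)"
  have pos: "real N ^ (r + 1) > 0" "real r + 1 > 0" using assms by auto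
  have "1 / (real r + 1) \<le> S / real N ^ (r + 1)"
    using power_sum_bounds(1)[of N r] pos unfolding S_def by (simp add: divide_simps mult_ac)
  moreover have "S \<le> real N ^ (r + 1) / (real r + 1) + real N ^ r"
    using power_sum_bounds(2)[of r N] pos(2) unfolding S_def by (simp add: field_simps)
  then have "S / real N ^ (r + 1) \<le> (real N ^ (r + 1) / (real r + 1) + real N ^ r) / real N ^ (r + 1)"
    using pos(1) by (intro divide_right_mono) auto
  moreover have "\<dots> = 1 / (real r + 1) + 1 / real N"
    using assms pos(2) by (simp add: add_divide_distrib)
  ultimately show ?thesis
    unfolding power_mean_def S_def[symmetric] by (auto simp: abs_le_iff)
qed

section \<open>Inclusion-exclusion for the generalized coprimality condition\<close>

lemma prod_primes_power_dvd_iff: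
  fixes m s :: nat
  assumes "finite T" "\<And>p. p \<in> T \<Longrightarrow> prime p"
  shows "(\<Prod>T) ^ s dvd m \<longleftrightarrow> (\<forall>p\<in>T. p ^ s dvd m)"
  using assms
proof (induction T rule: finite_induct)
  case empty
  then show ?case by simp
next
  case (insert p T)
  have "coprime p (\<Prod>T)"
    using insert.hyps insert.prems by (intro prod_coprime_right primes_coprime) auto
  then have "coprime (p ^ s) ((\<Prod>T) ^ s)" by simp
  then have "p ^ s * (\<Prod>T) ^ s dvd m \<longleftrightarrow> p ^ s dvd m \<and> (\<Prod>T) ^ s dvd m"
    by (auto intro: divides_mult dvd_mult_left dvd_mult_right)
  then show ?case
    using insert by (simp add: power_mult_distrib)
qed

lemma prime_factors_prod_primes:
  fixes P :: "nat set"
  assumes "finite P" "\<And>p. p \<in> P \<Longrightarrow> prime p"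
  shows "prime_factors (\<Prod>P) = P"
  using assms
proof (induction P rule: finite_induct)
  case empty
  then show ?case by simp
next
  case (insert p P)
  have "0 \<notin> insert p P"
    using insert.prems not_prime_0 by blast
  then have "\<Prod>P \<noteq> 0" "p \<noteq> 0"
    using insert.hyps by auto
  then show ?case
    using insert by (simp add: prime_factors_product prime_prime_factors)
qed

text \<open>A common divisor \<open>d ^ s\<close> other than 1 forces \<open>d dvd k\<close>, and
  any prime factor \<open>p\<close> of \<open>d\<close> then gives a common divisor
  \<open>p ^ s\<close>. So prime \<open>d\<close> suffice to detect a nontrivial generalized
  gcd.\<close>

lemma gen_gcd_power_eq_1_iff:
  fixes k m s :: nat
  assumes "k > 0" "s > 0" "m > 0"
  shows "gen_gcd s m (k ^ s) = 1 \<longleftrightarrow> (\<forall>p\<in>prime_factors k. \<not> p ^ s dvd m)"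
proof -
  define A where "A = {d ^ s | d. d ^ s dvd m \<and> d ^ s dvd k ^ s}"
  have fin: "finite A"
    by (rule finite_subset[of _ "{..m}"]) (use assms in \<open>auto simp: A_def dest: dvd_imp_le\<close>)
  have one: "1 \<in> A" unfolding A_def by (auto intro!: exI[of _ 1])
  show ?thesis
  proof
    assume "gen_gcd s m (k ^ s) = 1"
    then have M: "Max A = 1" by (simp add: gen_gcd_def A_def)
    show "\<forall>p\<in>prime_factors k. \<not> p ^ s dvd m"
    proof (intro ballI notI)
      fix p assume p: "p \<in> prime_factors k" "p ^ s dvd m"
      then have "p ^ s \<in> A" by (auto simp: A_def intro!: exI[of _ p] dvd_power_same)
      then have "p ^ s \<le> 1" using M fin Max_ge by metis
      moreover have "p > 1" using p(1) by (intro prime_gt_1_nat) auto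
      ultimately show False using one_less_power[of p s] assms(2) by linarith
    qed
  next
    assume *: "\<forall>p\<in>prime_factors k. \<not> p ^ s dvd m"
    have "x = 1" if "x \<in> A" for x
    proof (rule ccontr)
      assume "x \<noteq> 1"
      from that obtain d where d: "x = d ^ s" "d ^ s dvd m" "d ^ s dvd k ^ s"
        by (auto simp: A_def)
      then have "d dvd k" using assms(2) by (simp add: pow_divides_pow_iff)
      moreover have "d \<noteq> 1" using \<open>x \<noteq> 1\<close> d by auto
      then obtain p where p: "prime p" "p dvd d" using prime_factor_nat by blast
      ultimately have "p \<in> prime_factors k"
        using assms(1) by (auto simp: in_prime_factors_iff)
      moreover have "p ^ s dvd m" using p(2) d(2) dvd_power_same dvd_trans by blast
      ultimately show False using * by blast
    qed
    then have "A = {1}" using one by blast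
    then show "gen_gcd s m (k ^ s) = 1" by (simp add: gen_gcd_def A_def)
  qed
qed

lemma prod_one_minus_expand:
  fixes f :: "'a \<Rightarrow> 'b :: comm_ring_1"
  assumes "finite P"
  shows "(\<Prod>p\<in>P. 1 - f p) = (\<Sum>T\<in>Pow P. (-1) ^ card T * prod f T)"
  using prod_add[OF assms, of "\<lambda>p. - f p" "\<lambda>_. 1"] by (simp add: prod_uminus)

text \<open>The indicator is the product over \<open>p\<close> of 1 minus the indicator of
  \<open>p ^ s dvd m\<close>. Multiplying out, the conditions for all \<open>p\<close> in
  \<open>T\<close> merge into one divisibility, since powers of distinct primes are coprime.\<close>

lemma coprime_indicator_expand:
  fixes k m s :: nat
  assumes "k > 0" "s > 0" "m > 0"
  shows "(if gen_gcd s m (k ^ s) = 1 then 1 else 0 :: complex) =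
    (\<Sum>T\<in>Pow (prime_factors k). (-1) ^ card T * (if (\<Prod>T) ^ s dvd m then 1 else 0))"
proof -
  have ind: "(\<Prod>p\<in>T. if p ^ s dvd m then 1 else 0 :: complex) = (if (\<Prod>T) ^ s dvd m then 1 else 0)"
    if "T \<subseteq> prime_factors k" for T
  proof -
    have "finite T" using that finite_subset by blast
    moreover have "\<And>p. p \<in> T \<Longrightarrow> prime p" using that by auto
    ultimately show ?thesis
      using prod_primes_power_dvd_iff[of T s m] by (auto intro: prod_zero)
  qed
  have "(if gen_gcd s m (k ^ s) = 1 then 1 else 0 :: complex) =
      (\<Prod>p\<in>prime_factors k. 1 - (if p ^ s dvd m then 1 else 0))"
    unfolding gen_gcd_power_eq_1_iff[OF assms] by (auto intro!: prod_zero[symmetric])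
  also have "\<dots> = (\<Sum>T\<in>Pow (prime_factors k). (-1) ^ card T * (\<Prod>p\<in>T. if p ^ s dvd m then 1 else 0))"
    by (rule prod_one_minus_expand) simp
  finally show ?thesis
    using ind by simp
qed

section \<open>Root-of-unity sums, the Ramanujan sum and its moment\<close>

lemma sum_multiples_reindex:
  fixes f :: "nat \<Rightarrow> 'a :: comm_monoid_add"
  assumes "D > 0"
  shows "(\<Sum>m | m \<in> {1..D * N} \<and> D dvd m. f m) = (\<Sum>i=1..N. f (D * i))"
  by (rule sum.reindex_bij_witness[of _ "\<lambda>i. D * i" "\<lambda>m. m div D"])
    (use assms in \<open>auto simp: Suc_le_eq elim!: dvdE\<close>)

lemma sum_exp_root_of_unity:
  fixes N j :: nat
  assumes "N > 0"
  shows "(\<Sum>i=1..N. exp (2 * of_real pi * \<i> * of_nat j * of_nat i / of_nat N)) =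
    (if N dvd j then of_nat N else (0 :: complex))"
proof -
  define z where "z = exp (2 * of_real pi * \<i> * of_nat j / of_nat N)"
  have zi: "exp (2 * of_real pi * \<i> * of_nat j * of_nat i / of_nat N) = z ^ i" for i
    unfolding z_def by (simp add: mult_ac flip: exp_of_nat_mult)
  have z1: "z = 1 \<longleftrightarrow> N dvd j"
    unfolding z_def using complex_root_unity_eq_1[of N j] assms by simp
  have zN: "z ^ N = 1"
    using complex_root_unity[of N j] assms unfolding z_def by simp
  show ?thesis
  proof (cases "N dvd j")
    case True
    then show ?thesis using z1 by (simp add: zi)
  next
    case False
    \<comment> \<open>Shifting the index pulls out one factor \<open>z\<close>; the remaining
      geometric sum vanishes because \<open>z ^ N = 1\<close> and
      \<open>z \<noteq> 1\<close>.\<close>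
    have "(\<Sum>i=1..N. z ^ i) = (\<Sum>i<N. z * z ^ i)"
      by (rule sum.reindex_bij_witness[of _ Suc "\<lambda>i. i - 1"]) (auto simp flip: power_Suc)
    also have "\<dots> = 0"
      using False z1 zN geometric_sum[of z N] by (simp flip: sum_distrib_left)
    finally show ?thesis using False by (simp add: zi)
  qed
qed

text \<open>This is Cohen's formula: the sum of \<open>\<mu>(k / d) * d ^ s\<close> over the
  divisors \<open>d\<close> of \<open>k\<close> with \<open>d ^ s dvd j\<close>, where
  \<open>d = k div \<Prod>T\<close>. After inclusion-exclusion over \<open>m\<close>, the surviving
  \<open>m\<close> are the multiples of \<open>(\<Prod>T) ^ s\<close>, and their exponentials form a
  full root-of-unity sum modulo \<open>d ^ s\<close>.\<close>

lemma cohen_sum_eq: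
  fixes k s j :: nat
  assumes "k > 0" "s > 0"
  shows "cohen_sum s k (int j) =
    (\<Sum>T\<in>Pow (prime_factors k). (-1) ^ card T *
      (if (k div \<Prod>T) ^ s dvd j then of_nat ((k div \<Prod>T) ^ s) else 0))"
proof -
  define e :: "nat \<Rightarrow> complex"
    where "e m = exp (2 * of_real pi * \<i> * of_nat j * of_nat m / of_nat (k ^ s))" for m
  have inner: "(\<Sum>m=1..k ^ s. if (\<Prod>T) ^ s dvd m then e m else 0) =
      (if (k div \<Prod>T) ^ s dvd j then of_nat ((k div \<Prod>T) ^ s) else 0)"
    if T: "T \<in> Pow (prime_factors k)" for T
  proof -
    have "finite T" "\<And>p. p \<in> T \<Longrightarrow> prime p" "\<forall>p\<in>T. p dvd k"
      using T finite_subset by (auto simp: in_prime_factors_iff)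
    \<comment> \<open>The divisibility criterion is used here with exponent 1.\<close>
    then have "\<Prod>T dvd k" using prod_primes_power_dvd_iff[of T 1 k] by simp
    then obtain d where d: "k = \<Prod>T * d" by (elim dvdE)
    have pos: "\<Prod>T > 0" "d > 0" using d assms by (auto intro!: Nat.gr0I)
    have kd: "k div \<Prod>T = d" using d pos by simp
    have ks: "k ^ s = (\<Prod>T) ^ s * d ^ s" using d by (simp add: power_mult_distrib)
    have "(\<Sum>m=1..k ^ s. if (\<Prod>T) ^ s dvd m then e m else 0) =
        (\<Sum>m | m \<in> {1..k ^ s} \<and> (\<Prod>T) ^ s dvd m. e m)"
      by (rule sum.inter_filter[symmetric]) simp
    also have "\<dots> = (\<Sum>i=1..d ^ s. e ((\<Prod>T) ^ s * i))"
      unfolding ks using pos by (intro sum_multiples_reindex) simp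
    also have "\<dots> = (\<Sum>i=1..d ^ s. exp (2 * of_real pi * \<i> * of_nat j * of_nat i / of_nat (d ^ s)))"
    proof (intro sum.cong refl)
      fix i
      \<comment> \<open>This factor is common to numerator and denominator of the exponent and has
        to be nonzero to cancel.\<close>
      have "of_nat ((\<Prod>T) ^ s) \<noteq> (0 :: complex)"
        using pos by (simp only: of_nat_eq_0_iff) simp
      then show "e ((\<Prod>T) ^ s * i) = exp (2 * of_real pi * \<i> * of_nat j * of_nat i / of_nat (d ^ s))"
        unfolding e_def ks of_nat_mult
        by (simp only: mult.left_commute[of _ "of_nat ((\<Prod>T) ^ s)"]
            nonzero_mult_divide_mult_cancel_left not_False_eq_True)
    qed
    also have "\<dots> = (if d ^ s dvd j then of_nat (d ^ s) else 0)"
      using pos by (intro sum_exp_root_of_unity) simp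
    finally show ?thesis unfolding kd .
  qed
  have "{m. 1 \<le> m \<and> m \<le> k ^ s \<and> gen_gcd s m (k ^ s) = 1}
      = {m. m \<in> {1..k ^ s} \<and> gen_gcd s m (k ^ s) = 1}" by auto
  then have "cohen_sum s k (int j) = (\<Sum>m | m \<in> {1..k ^ s} \<and> gen_gcd s m (k ^ s) = 1. e m)"
    unfolding cohen_sum_def e_def by simp
  also have "\<dots> = (\<Sum>m=1..k ^ s. if gen_gcd s m (k ^ s) = 1 then e m else 0)"
    by (rule sum.inter_filter) simp
  also have "\<dots> = (\<Sum>m=1..k ^ s. (if gen_gcd s m (k ^ s) = 1 then 1 else 0) * e m)"
    by (intro sum.cong) auto
  also have "\<dots> = (\<Sum>m=1..k ^ s. \<Sum>T\<in>Pow (prime_factors k).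
      (-1) ^ card T * (if (\<Prod>T) ^ s dvd m then e m else 0))"
    by (intro sum.cong refl, subst coprime_indicator_expand[OF assms])
      (auto simp: sum_distrib_right intro!: sum.cong)
  also have "\<dots> = (\<Sum>T\<in>Pow (prime_factors k).
      (-1) ^ card T * (\<Sum>m=1..k ^ s. if (\<Prod>T) ^ s dvd m then e m else 0))"
    by (subst sum.swap) (simp add: sum_distrib_left)
  also have "\<dots> = (\<Sum>T\<in>Pow (prime_factors k). (-1) ^ card T *
      (if (k div \<Prod>T) ^ s dvd j then of_nat ((k div \<Prod>T) ^ s) else 0))"
    by (intro sum.cong refl) (simp only: inner)
  finally show ?thesis .
qed

text \<open>For fixed \<open>T\<close> put \<open>q = (\<Prod>T) ^ s\<close> and
  \<open>D = (k div \<Prod>T) ^ s\<close>. Only \<open>j = D * i\<close> with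
  \<open>i \<le> q\<close> contribute; \<open>j ^ r\<close> supplies \<open>D ^ r\<close> and the
  Ramanujan sum one more \<open>D\<close>. Dividing by
  \<open>k ^ (s * (r + 1)) = D ^ (r + 1) * q ^ (r + 1)\<close> leaves the power mean at
  \<open>q\<close>.\<close>

lemma cohen_moment_eq:
  assumes "k > 0" "s > 0"
  shows "cohen_moment s r k = of_real (sieve_sum s r 1 (prime_factors k))"
proof -
  have inner: "1 / of_nat (k ^ (s * (r + 1))) *
      (\<Sum>j=1..k ^ s. of_nat (j ^ r) * (if (k div \<Prod>T) ^ s dvd j then of_nat ((k div \<Prod>T) ^ s) else 0))
      = (of_real (power_mean r ((\<Prod>T) ^ s)) :: complex)"
    if T: "T \<in> Pow (prime_factors k)" for T
  proof -
    have "finite T" "\<And>p. p \<in> T \<Longrightarrow> prime p" "\<forall>p\<in>T. p dvd k"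
      using T finite_subset by (auto simp: in_prime_factors_iff)
    then have "\<Prod>T dvd k" using prod_primes_power_dvd_iff[of T 1 k] by simp
    then obtain d where d: "k = \<Prod>T * d" by (elim dvdE)
    have pos: "\<Prod>T > 0" "d > 0" using d assms by (auto intro!: Nat.gr0I)
    have kd: "k div \<Prod>T = d" using d pos by simp
    define q where "q = (\<Prod>T) ^ s"
    define D where "D = d ^ s"
    have qD: "q > 0" "D > 0" using pos by (simp_all add: q_def D_def)
    have ks: "k ^ s = D * q" using d by (simp add: power_mult_distrib q_def D_def)
    have "(\<Sum>j=1..k ^ s. of_nat (j ^ r) * (if D dvd j then of_nat D else 0 :: complex)) =
        (\<Sum>j=1..k ^ s. if D dvd j then of_nat (j ^ r) * of_nat D else 0)"
      by (intro sum.cong) auto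
    also have "\<dots> = (\<Sum>j | j \<in> {1..k ^ s} \<and> D dvd j. of_nat (j ^ r) * of_nat D)"
      by (rule sum.inter_filter[symmetric]) simp
    also have "\<dots> = (\<Sum>i=1..q. of_nat ((D * i) ^ r) * of_nat D)"
      unfolding ks using qD by (intro sum_multiples_reindex)
    also have "\<dots> = of_nat D ^ (r + 1) * (\<Sum>i=1..q. of_nat i ^ r)"
      by (simp add: power_mult_distrib sum_distrib_left mult_ac)
    finally have S: "(\<Sum>j=1..k ^ s. of_nat (j ^ r) * (if D dvd j then of_nat D else 0 :: complex)) =
        of_nat D ^ (r + 1) * (\<Sum>i=1..q. of_nat i ^ r)" .
    have "k ^ (s * (r + 1)) = D ^ (r + 1) * q ^ (r + 1)"
      by (simp only: power_mult ks power_mult_distrib)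
    then show ?thesis
      unfolding kd q_def[symmetric] D_def[symmetric] S power_mean_def
      using qD by simp
  qed
  have "cohen_moment s r k = (\<Sum>T\<in>Pow (prime_factors k). (-1) ^ card T *
      (1 / of_nat (k ^ (s * (r + 1))) *
      (\<Sum>j=1..k ^ s. of_nat (j ^ r) * (if (k div \<Prod>T) ^ s dvd j then of_nat ((k div \<Prod>T) ^ s) else 0))))"
    unfolding cohen_moment_def cohen_sum_eq[OF assms] sum_distrib_left
    by (subst sum.swap) (simp only: mult_ac)
  also have "\<dots> = (\<Sum>T\<in>Pow (prime_factors k). (-1) ^ card T * of_real (power_mean r ((\<Prod>T) ^ s)))"
    by (intro sum.cong refl) (simp only: inner)
  finally show ?thesis by (simp add: sieve_sum_def)
qed

section \<open>Sieve sums over large primes and their limits\<close>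

lemma sieve_sum_approx:
  assumes P: "finite P" "P \<noteq> {}" "\<And>p. p \<in> P \<Longrightarrow> prime p \<and> x \<le> real p"
    and "x > 0" "a > 0" "s > 0"
  shows "\<bar>sieve_sum s r a P - (power_mean r a - 1 / (real r + 1))\<bar> \<le> exp (real (card P) / x) - 1"
proof -
  define E where "E T = power_mean r (a * (\<Prod>T) ^ s) - 1 / (real r + 1)" for T
  \<comment> \<open>\<open>P\<close> is nonempty, so the product of the factors \<open>1 - 1\<close>
    vanishes; this allows \<open>1 / (r + 1)\<close> to be subtracted from every power mean.\<close>
  have zero: "(\<Sum>T\<in>Pow P. (-1 :: real) ^ card T) = 0"
    using prod_one_minus_expand[OF P(1), of "\<lambda>_. 1 :: real", symmetric] P(1,2)
    by (simp add: zero_power card_gt_0_iff)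
  have "sieve_sum s r a P = (\<Sum>T\<in>Pow P. (-1) ^ card T * E T + (-1) ^ card T * (1 / (real r + 1)))"
    unfolding sieve_sum_def E_def by (intro sum.cong) (auto simp: algebra_simps)
  also have "\<dots> = (\<Sum>T\<in>Pow P. (-1) ^ card T * E T) + (\<Sum>T\<in>Pow P. (-1) ^ card T) * (1 / (real r + 1))"
    by (simp only: sum.distrib sum_distrib_right)
  also have "\<dots> = (\<Sum>T\<in>Pow P. (-1) ^ card T * E T)"
    unfolding zero by simp
  \<comment> \<open>The empty set gives the main term; all other sets go into the error.\<close>
  also have "\<dots> = E {} + (\<Sum>T\<in>Pow P - {{}}. (-1) ^ card T * E T)"
    using P(1) by (subst sum.remove[of _ "{}"]) auto
  finally have "\<bar>sieve_sum s r a P - (power_mean r a - 1 / (real r + 1))\<bar> =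
      \<bar>\<Sum>T\<in>Pow P - {{}}. (-1) ^ card T * E T\<bar>"
    by (simp add: E_def)
  also have "\<dots> \<le> (\<Sum>T\<in>Pow P - {{}}. \<bar>(-1) ^ card T * E T\<bar>)"
    by (rule sum_abs)
  also have "\<dots> \<le> (\<Sum>T\<in>Pow P - {{}}. \<Prod>p\<in>T. 1 / real p)"
  proof (rule sum_mono)
    fix T assume "T \<in> Pow P - {{}}"
    then have "prime p" if "p \<in> T" for p using P(3) that by blast
    then have "\<Prod>T > 0" by (simp add: prod_pos prime_gt_0_nat)
    then have "\<Prod>T \<le> (\<Prod>T) ^ s" using \<open>s > 0\<close> by (simp add: self_le_power)
    also have "\<dots> \<le> a * (\<Prod>T) ^ s" using \<open>a > 0\<close> by simp
    finally have le: "\<Prod>T \<le> a * (\<Prod>T) ^ s" .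
    have "\<bar>(-1) ^ card T * E T\<bar> \<le> 1 / real (a * (\<Prod>T) ^ s)"
      unfolding E_def using \<open>\<Prod>T > 0\<close> \<open>a > 0\<close>
      by (simp only: abs_mult power_abs) (simp del: of_nat_mult add: power_mean_approx)
    also have "\<dots> \<le> 1 / real (\<Prod>T)"
      by (rule frac_le[OF _ _ _ of_nat_mono[OF le]]) (use \<open>\<Prod>T > 0\<close> in \<open>simp_all del: of_nat_prod\<close>)
    also have "\<dots> = (\<Prod>p\<in>T. 1 / real p)" by (simp add: prod_dividef)
    finally show "\<bar>(-1) ^ card T * E T\<bar> \<le> (\<Prod>p\<in>T. 1 / real p)" .
  qed
  also have "\<dots> = (\<Sum>T\<in>Pow P. \<Prod>p\<in>T. 1 / real p) - 1"
    using P(1) by (subst sum.remove[of "Pow P" "{}"]) auto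
  \<comment> \<open>The multiplicative bound on the single terms lets the sum over subsets
    factor.\<close>
  also have "(\<Sum>T\<in>Pow P. \<Prod>p\<in>T. 1 / real p) = (\<Prod>p\<in>P. 1 + 1 / real p)"
    using prod_add[OF P(1), of "\<lambda>p. 1 / real p" "\<lambda>_. 1"] by (simp add: add.commute)
  also have "\<dots> \<le> exp (\<Sum>p\<in>P. 1 / real p)"
    by (rule prod_le_exp_sum) simp
  also have "\<dots> \<le> exp (real (card P) / x)"
  proof -
    have "(\<Sum>p\<in>P. 1 / real p) \<le> (\<Sum>p\<in>P. 1 / x)"
      using P(3) \<open>x > 0\<close> by (intro sum_mono frac_le) auto
    then show ?thesis by simp
  qed
  finally show ?thesis by simp
qed

text \<open>The hypotheses are asked only eventually: in the applications nothing is known about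
  \<open>k 0\<close>, and the constructed prime sets may be empty for small
  \<open>n\<close>.\<close>

lemma tendsto_sieve_sum:
  assumes P: "\<forall>\<^sub>F n in sequentially. finite (P n) \<and> P n \<noteq> {} \<and> (\<forall>p\<in>P n. prime p \<and> x n \<le> real p)"
    and x: "\<forall>\<^sub>F n in sequentially. x n > 0"
    and lim: "(\<lambda>n. real (card (P n)) / x n) \<longlonglongrightarrow> 0"
    and "a > 0" "s > 0"
  shows "(\<lambda>n. sieve_sum s r a (P n)) \<longlonglongrightarrow> power_mean r a - 1 / (real r + 1)"
proof (rule Lim_transform)
  show "(\<lambda>n. power_mean r a - 1 / (real r + 1)) \<longlonglongrightarrow> power_mean r a - 1 / (real r + 1)"
    by simp
  have "(\<lambda>n. exp (real (card (P n)) / x n) - 1) \<longlonglongrightarrow> exp 0 - 1"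
    by (intro tendsto_intros lim)
  then have "(\<lambda>n. exp (real (card (P n)) / x n) - 1) \<longlonglongrightarrow> 0" by simp
  then show "(\<lambda>n. sieve_sum s r a (P n) - (power_mean r a - 1 / (real r + 1))) \<longlonglongrightarrow> 0"
  proof (rule Lim_null_comparison[rotated])
    show "\<forall>\<^sub>F n in sequentially. norm (sieve_sum s r a (P n) - (power_mean r a - 1 / (real r + 1)))
        \<le> exp (real (card (P n)) / x n) - 1"
      using P x
      by eventually_elim (use assms(4,5) in \<open>auto intro!: sieve_sum_approx\<close>)
  qed
qed

section \<open>Splitting off one prime\<close>

lemma power_mean_1 [simp]: "power_mean r (Suc 0) = 1"
  by (simp add: power_mean_def)

text \<open>Each subset avoiding \<open>p\<close> is paired with the one obtained by adding
  \<open>p\<close>, which flips the sign and multiplies the argument by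
  \<open>p ^ s\<close>.\<close>

lemma sieve_sum_insert:
  assumes "finite P" "p \<notin> P"
  shows "sieve_sum s r a (insert p P) = sieve_sum s r a P - sieve_sum s r (a * p ^ s) P"
proof -
  have inj: "inj_on (insert p) (Pow P)" using assms(2) by (auto simp: inj_on_def)
  have "sieve_sum s r a (insert p P) =
      sieve_sum s r a P + (\<Sum>T\<in>insert p ` Pow P. (-1) ^ card T * power_mean r (a * (\<Prod>T) ^ s))"
    unfolding sieve_sum_def Pow_insert using assms by (intro sum.union_disjoint) auto
  also have "(\<Sum>T\<in>insert p ` Pow P. (-1) ^ card T * power_mean r (a * (\<Prod>T) ^ s)) =
      (\<Sum>T\<in>Pow P. - ((-1) ^ card T * power_mean r (a * p ^ s * (\<Prod>T) ^ s)))"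
  proof (subst sum.reindex[OF inj], intro sum.cong refl, unfold o_def)
    fix T assume "T \<in> Pow P"
    then have "finite T" "p \<notin> T" using assms finite_subset by auto
    then show "(-1) ^ card (insert p T) * power_mean r (a * \<Prod>(insert p T) ^ s) =
        - ((-1) ^ card T * power_mean r (a * p ^ s * (\<Prod>T) ^ s))"
      by (simp add: power_mult_distrib mult_ac)
  qed
  also have "\<dots> = - sieve_sum s r (a * p ^ s) P"
    by (simp only: sum_negf sieve_sum_def)
  finally show ?thesis by simp
qed

text \<open>\<open>power_sum\<close> stops at \<open>N - 1\<close>, so the term \<open>i = N\<close>
  is split off and contributes \<open>1 / real N\<close>.\<close>

lemma power_mean_eq_power_sum:
  assumes "N > 0"
  shows "power_mean r N = 1 / real N + real (power_sum r N) / real N ^ (r + 1)"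
proof -
  have "{1..N} = insert N {1..N - 1}" using assms by auto
  then have "(\<Sum>i=1..N. real i ^ r) = real N ^ r + (\<Sum>i=1..N - 1. real i ^ r)"
    using assms by (subst \<open>{1..N} = _\<close>, subst sum.insert) auto
  then show ?thesis
    unfolding power_mean_def power_sum_def using assms by (simp add: add_divide_distrib)
qed

section \<open>Choice of the primes and asymptotics of their number\<close>

lemma ex_large_prime_sets:
  fixes m :: "nat \<Rightarrow> nat"
  obtains P where "\<And>n. finite (P n)" "\<And>n. card (P n) = m n"
    "\<And>n p. p \<in> P n \<Longrightarrow> prime p \<and> n * m n + 2 < p"
proof -
  \<comment> \<open>Beyond the threshold \<open>n * m n + 2\<close> the reciprocals of
    \<open>m n\<close> primes sum to at most \<open>1 / n\<close> for \<open>n > 0\<close>; the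
    summand 2 keeps the prime 2 itself out of the set.\<close>
  have "\<exists>Q. finite Q \<and> card Q = m n \<and> Q \<subseteq> {p. prime p \<and> n * m n + 2 < p}" for n
  proof (rule infinite_arbitrarily_large)
    show "infinite {p. prime p \<and> n * m n + 2 < p}"
      unfolding infinite_nat_iff_unbounded
      by (metis (mono_tags, lifting) bigger_prime max_less_iff_conj mem_Collect_eq)
  qed
  then obtain P where "\<And>n. finite (P n) \<and> card (P n) = m n \<and> P n \<subseteq> {p. prime p \<and> n * m n + 2 < p}"
    by metis
  then show ?thesis by (intro that[of P]) auto
qed

lemma asymp_equiv_floor_and_Suc:
  fixes c :: real
  assumes "c > 0"
  shows "(\<lambda>n. real (nat \<lfloor>c * (real n / ln (real n))\<rfloor>)) \<sim>[sequentially] (\<lambda>n. c * (real n / ln (real n)))"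
    and "(\<lambda>n. real (Suc (nat \<lfloor>c * (real n / ln (real n))\<rfloor>))) \<sim>[sequentially] (\<lambda>n. c * (real n / ln (real n)))"
proof -
  let ?x = "\<lambda>n. c * (real n / ln (real n))"
  have l: "(\<lambda>n. ?x n - 1) \<sim>[sequentially] ?x" "(\<lambda>n. ?x n + 1) \<sim>[sequentially] ?x"
    using assms by real_asymp+
  \<comment> \<open>Positivity rules out truncation by \<open>nat\<close>, so both counts differ
    from \<open>?x n\<close> by at most 1.\<close>
  have "\<forall>\<^sub>F n in sequentially. ?x n > 0"
    using assms by real_asymp
  then have b: "\<forall>\<^sub>F n in sequentially. ?x n - 1 \<le> real (nat \<lfloor>?x n\<rfloor>) \<and> real (nat \<lfloor>?x n\<rfloor>) \<le> ?x n"
    by eventually_elim linarith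
  show "(\<lambda>n. real (nat \<lfloor>?x n\<rfloor>)) \<sim>[sequentially] ?x"
    by (rule asymp_equiv_sandwich_real[OF l(1) asymp_equiv_refl])
      (use b in eventually_elim, auto)
  show "(\<lambda>n. real (Suc (nat \<lfloor>?x n\<rfloor>))) \<sim>[sequentially] ?x"
    by (rule asymp_equiv_sandwich_real[OF l(1) l(2)])
      (use b in eventually_elim, simp only: atLeastAtMost_iff of_nat_Suc, linarith)
qed

section \<open>Assembly of the three limits\<close>

theorem theorem3p2:
  fixes s :: nat
  assumes "s \<ge> 1"
  shows
    "(\<forall>k :: nat \<Rightarrow> nat.
        (\<forall>n\<ge>1. k n \<ge> 2) \<longrightarrow>
        (\<exists>B. \<forall>n\<ge>1. omega (k n) \<le> B) \<longrightarrow>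
        filterlim (\<lambda>n. Min (prime_factors (k n))) at_top sequentially \<longrightarrow>
        (\<forall>r\<ge>1. (\<lambda>n. cohen_moment s r (k n)) \<longlonglongrightarrow> of_real (1 - 1 / (real r + 1))))
   \<and> (\<forall>lam :: real. lam > 1 \<longrightarrow>
        (\<exists>k :: nat \<Rightarrow> nat.
           (\<forall>n\<ge>1. k n > 0) \<and>
           (\<lambda>n. real (omega (k n))) \<sim>[sequentially] (\<lambda>n. (lam - 1) * (real n / ln (real n))) \<and>
           (\<forall>r\<ge>1. (\<lambda>n. cohen_moment s r (k n)) \<longlonglongrightarrow> of_real (1 - 1 / (real r + 1)))))
   \<and> (\<forall>lam :: real. lam > 1 \<longrightarrow>
        (\<exists>k :: nat \<Rightarrow> nat.
           (\<forall>n\<ge>1. k n > 0) \<and>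
           (\<lambda>n. real (omega (k n))) \<sim>[sequentially] (\<lambda>n. (lam - 1) * (real n / ln (real n))) \<and>
           (\<forall>r\<ge>1. (\<lambda>n. cohen_moment s r (k n)) \<longlonglongrightarrow>
              of_real ((2 ^ s - 1) / 2 ^ s
                       - real (power_sum r (2 ^ s)) / 2 ^ (s * (r + 1))))))"
proof (intro conjI allI impI)
  have s: "s > 0" using assms by simp
  {
    fix k :: "nat \<Rightarrow> nat" and r :: nat
    assume k2: "\<forall>n\<ge>1. k n \<ge> 2" and bd: "\<exists>B. \<forall>n\<ge>1. omega (k n) \<le> B"
      and inf: "filterlim (\<lambda>n. Min (prime_factors (k n))) at_top sequentially"
    \<comment> \<open>First claim: the least prime factor serves as lower bound \<open>x n\<close>,
      and the reciprocals of the prime factors sum to at most \<open>B / x n\<close>.\<close>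
    define x where "x n = real (Min (prime_factors (k n)))" for n
    from bd obtain B where B: "\<forall>n\<ge>1. omega (k n) \<le> B" by blast
    have x: "filterlim x at_top sequentially"
      unfolding x_def using inf by (rule filterlim_compose[OF filterlim_real_sequentially])
    then have xpos: "\<forall>\<^sub>F n in sequentially. x n > 0"
      by (rule filterlim_at_top_dense[THEN iffD1, rule_format])
    have "(\<lambda>n. real B / x n) \<longlonglongrightarrow> 0"
      by (rule real_tendsto_divide_at_top[OF tendsto_const x])
    then have lim: "(\<lambda>n. real (card (prime_factors (k n))) / x n) \<longlonglongrightarrow> 0"
    proof (rule Lim_null_comparison[rotated])
      show "\<forall>\<^sub>F n in sequentially. norm (real (card (prime_factors (k n))) / x n) \<le> real B / x n"
        using xpos eventually_ge_at_top[of 1]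
        by eventually_elim (use B in \<open>auto simp: omega_def intro!: divide_right_mono\<close>)
    qed
    have "\<forall>\<^sub>F n in sequentially. finite (prime_factors (k n)) \<and> prime_factors (k n) \<noteq> {} \<and>
        (\<forall>p\<in>prime_factors (k n). prime p \<and> x n \<le> real p)"
      using eventually_ge_at_top[of 1]
    proof eventually_elim
      case (elim n)
      then have "k n \<ge> 2" using k2 by auto
      then obtain p where "prime p" "p dvd k n" using prime_factor_nat[of "k n"] by auto
      then have "p \<in> prime_factors (k n)" using \<open>k n \<ge> 2\<close> by (auto simp: in_prime_factors_iff)
      then show ?case by (auto simp: x_def)
    qed
    from tendsto_sieve_sum[OF this xpos lim, of 1 s r]
    have "(\<lambda>n. sieve_sum s r 1 (prime_factors (k n))) \<longlonglongrightarrow> 1 - 1 / (real r + 1)"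
      using s by simp
    then have "(\<lambda>n. of_real (sieve_sum s r 1 (prime_factors (k n))) :: complex)
        \<longlonglongrightarrow> of_real (1 - 1 / (real r + 1))"
      by (rule tendsto_of_real)
    moreover have "\<forall>\<^sub>F n in sequentially.
        of_real (sieve_sum s r 1 (prime_factors (k n))) = cohen_moment s r (k n)"
      using eventually_ge_at_top[of 1]
    proof eventually_elim
      case (elim n)
      then have "k n \<ge> 2" using k2 by auto
      then show ?case using s by (simp add: cohen_moment_eq)
    qed
    ultimately show "(\<lambda>n. cohen_moment s r (k n)) \<longlonglongrightarrow> of_real (1 - 1 / (real r + 1))"
      by (rule Lim_transform_eventually)
  }
  fix lam :: real
  assume "lam > 1"
  \<comment> \<open>The remaining two claims share prime sets of this size. For
    \<open>n \<le> 1\<close> the quotient evaluates to 0, hence \<open>m n = 0\<close>.\<close>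
  define m where "m n = nat \<lfloor>(lam - 1) * (real n / ln (real n))\<rfloor>" for n :: nat
  from \<open>lam > 1\<close>
  have m: "(\<lambda>n. real (m n)) \<sim>[sequentially] (\<lambda>n. (lam - 1) * (real n / ln (real n)))"
    and Suc_m: "(\<lambda>n. real (Suc (m n))) \<sim>[sequentially] (\<lambda>n. (lam - 1) * (real n / ln (real n)))"
    unfolding m_def using asymp_equiv_floor_and_Suc[of "lam - 1"] by auto
  have "\<forall>\<^sub>F n in sequentially. (lam - 1) * (real n / ln (real n)) \<ge> 1"
    using \<open>lam > 1\<close> by real_asymp
  then have m_pos: "\<forall>\<^sub>F n in sequentially. m n > 0"
    by eventually_elim (simp add: m_def)
  obtain P where P: "\<And>n. finite (P n)" "\<And>n. card (P n) = m n"
    "\<And>n p. p \<in> P n \<Longrightarrow> prime p \<and> n * m n + 2 < p"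
    using ex_large_prime_sets[of m] by blast
  define x where "x n = real (n * m n + 2)" for n
  have x_pos: "\<forall>\<^sub>F n in sequentially. x n > 0" by (simp add: x_def add_pos_nonneg)
  \<comment> \<open>The threshold was chosen so that \<open>m n / x n\<close> is at most
    \<open>1 / n\<close>.\<close>
  have lim: "(\<lambda>n. real (card (P n)) / x n) \<longlonglongrightarrow> 0"
  proof (rule Lim_null_comparison[OF _ lim_1_over_n])
    show "\<forall>\<^sub>F n in sequentially. norm (real (card (P n)) / x n) \<le> 1 / real n"
      using eventually_gt_at_top[of 0]
    proof eventually_elim
      case (elim n)
      have "x n > 0" unfolding x_def of_nat_0_less_iff by simp
      moreover have "real (m n) * real n \<le> x n" by (simp add: x_def)
      ultimately show ?case using elim by (simp add: P(2) field_simps)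
    qed
  qed
  have ev: "\<forall>\<^sub>F n in sequentially. finite (P n) \<and> P n \<noteq> {} \<and> (\<forall>p\<in>P n. prime p \<and> x n \<le> real p)"
    using m_pos
  proof eventually_elim
    case (elim n)
    then have "P n \<noteq> {}" using P(2)[of n] by auto
    moreover have "x n \<le> real p" if "p \<in> P n" for p
      using P(3)[OF that] unfolding x_def by (simp only: of_nat_le_iff less_imp_le)
    ultimately show ?case using P by blast
  qed
  \<comment> \<open>\<open>a\<close> and \<open>r\<close> stay free: \<open>a = 1\<close> serves
    both claims, \<open>a = 2 ^ s\<close> only the last one.\<close>
  note sieve = tendsto_sieve_sum[OF ev x_pos lim _ s]
  have lim1: "(\<lambda>n. sieve_sum s r 1 (P n)) \<longlonglongrightarrow> 1 - 1 / (real r + 1)" for r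
    using sieve[of 1 r] by simp
  have pf: "prime_factors (\<Prod>(P n)) = P n" for n
    using P by (intro prime_factors_prod_primes) auto
  have pos: "\<Prod>(P n) > 0" for n
    using P(3) by (auto intro!: prod_pos simp: prime_gt_0_nat)
  show "\<exists>k :: nat \<Rightarrow> nat. (\<forall>n\<ge>1. k n > 0) \<and>
      (\<lambda>n. real (omega (k n))) \<sim>[sequentially] (\<lambda>n. (lam - 1) * (real n / ln (real n))) \<and>
      (\<forall>r\<ge>1. (\<lambda>n. cohen_moment s r (k n)) \<longlonglongrightarrow> of_real (1 - 1 / (real r + 1)))"
  proof (intro exI[of _ "\<lambda>n. \<Prod>(P n)"] conjI allI impI)
    show "(\<lambda>n. real (omega (\<Prod>(P n)))) \<sim>[sequentially] (\<lambda>n. (lam - 1) * (real n / ln (real n)))"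
      using m by (simp add: omega_def pf P(2))
    show "(\<lambda>n. cohen_moment s r (\<Prod>(P n))) \<longlonglongrightarrow> of_real (1 - 1 / (real r + 1))" for r
      unfolding cohen_moment_eq[OF pos s] pf by (intro tendsto_of_real lim1)
  qed (rule pos)
  \<comment> \<open>Adjoining 2 therefore raises the number of prime divisors to
    \<open>Suc (m n)\<close>, which has the same asymptotics.\<close>
  have two: "2 \<notin> P n" for n using P(3)[of 2 n] by auto
  have pf2: "prime_factors (\<Prod>(insert 2 (P n))) = insert 2 (P n)" for n
    using P by (intro prime_factors_prod_primes) auto
  have pos2: "\<Prod>(insert 2 (P n)) > 0" for n
    using P(3) by (auto intro!: prod_pos simp: prime_gt_0_nat)
  show "\<exists>k :: nat \<Rightarrow> nat. (\<forall>n\<ge>1. k n > 0) \<and>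
      (\<lambda>n. real (omega (k n))) \<sim>[sequentially] (\<lambda>n. (lam - 1) * (real n / ln (real n))) \<and>
      (\<forall>r\<ge>1. (\<lambda>n. cohen_moment s r (k n)) \<longlonglongrightarrow>
        of_real ((2 ^ s - 1) / 2 ^ s - real (power_sum r (2 ^ s)) / 2 ^ (s * (r + 1))))"
  proof (intro exI[of _ "\<lambda>n. \<Prod>(insert 2 (P n))"] conjI allI impI)
    show "(\<lambda>n. real (omega (\<Prod>(insert 2 (P n))))) \<sim>[sequentially] (\<lambda>n. (lam - 1) * (real n / ln (real n)))"
      unfolding omega_def pf2 using Suc_m by (simp add: P two)
    fix r
    \<comment> \<open>With 2 split off, both sieve sums run over large primes only. Their limits
      share the term \<open>- 1 / (r + 1)\<close>, which cancels in the difference and leaves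
      \<open>1 - power_mean r (2 ^ s)\<close>.\<close>
    have "(\<lambda>n. sieve_sum s r 1 (P n) - sieve_sum s r (1 * 2 ^ s) (P n)) \<longlonglongrightarrow>
        (1 - 1 / (real r + 1)) - (power_mean r (1 * 2 ^ s) - 1 / (real r + 1))"
      by (intro tendsto_diff lim1 sieve) simp
    also have "(1 - 1 / (real r + 1)) - (power_mean r (1 * 2 ^ s) - 1 / (real r + 1)) =
        (2 ^ s - 1) / 2 ^ s - real (power_sum r (2 ^ s)) / 2 ^ (s * (r + 1))"
      by (simp add: power_mean_eq_power_sum diff_divide_distrib power_mult power_add)
    finally show "(\<lambda>n. cohen_moment s r (\<Prod>(insert 2 (P n)))) \<longlonglongrightarrow>
        of_real ((2 ^ s - 1) / 2 ^ s - real (power_sum r (2 ^ s)) / 2 ^ (s * (r + 1)))"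
      unfolding cohen_moment_eq[OF pos2 s] pf2 sieve_sum_insert[OF P(1) two]
      by (rule tendsto_of_real)
  qed (rule pos2)
qed

end
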